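(* It is not true that for all integers $k\ge 2$ and $n\ge 3k$ one has $$ar(n,kC_3)=\max\left\{\binom{3k-1}{2}+n-3k+1,\ \left\lfloor\frac{(n-k+2)^2}{4}\right\rfloor+(k-2)(n-k+2)+\binom{k-2}{2}+1\right\}.$$ That is, there exist integers $k\ge 2$ and $n\ge 3k$ for which this equality fails.
   Context: $kC_3$ denotes the vertex-disjoint union of $k$ triangles. An edge-coloring of a graph $G$ is a mapping $f:E(G)\to\mathbb{N}$ (not necessarily proper). A subgraph of an edge-colored graph is called rainbow if its edges are assigned pairwise different colors; in particular, a rainbow $kC_3$ is a copy of $kC_3$ all of whose $3k$ edges have pairwise different colors. For a positive integer $n$ and a graph $H$, the anti-Ramsey number $ar(n,H)$ is the maximum number of colors (i.e. of distinct values attained) in an edge-coloring of the complete graph $K_n$ that contains no rainbow $H$ as a subgraph. Binomial coefficients satisfy $\binom{0}{2}=\binom{1}{2}=0$. *)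

theory Defs
  imports Complex_Main "HOL-Library.Ramsey"
begin

(* A simple graph is a pair (vertex set, edge set), where edges are 2-element sets of vertices. *)
type_synonym 'a graph = "'a set \<times> 'a set set"

abbreviation verts :: "'a graph \<Rightarrow> 'a set" where "verts \<equiv> fst"
abbreviation edges :: "'a graph \<Rightarrow> 'a set set" where "edges \<equiv> snd"

definition simple_graph :: "'a graph \<Rightarrow> bool" where
  "simple_graph G \<longleftrightarrow> edges G \<subseteq> [verts G]\<^bsup>2\<^esup>"

definition subgraph :: "'a graph \<Rightarrow> 'a graph \<Rightarrow> bool" where
  "subgraph S G \<longleftrightarrow> simple_graph S \<and> verts S \<subseteq> verts G \<and> edges S \<subseteq> edges G"

definition graph_iso :: "'a graph \<Rightarrow> 'b graph \<Rightarrow> bool" where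
  "graph_iso G H \<longleftrightarrow>
     (\<exists>\<phi>. bij_betw \<phi> (verts G) (verts H) \<and> (\<lambda>e. \<phi> ` e) ` edges G = edges H)"

definition complete_graph :: "nat \<Rightarrow> nat graph" where
  "complete_graph n = ({..<n}, [{..<n}]\<^bsup>2\<^esup>)"

(* The vertices (i, 0), (i, 1), (i, 2) span the i-th triangle. *)
definition disjoint_triangles :: "nat \<Rightarrow> (nat \<times> nat) graph" where
  "disjoint_triangles k =
     ({..<k} \<times> {..<3}, {{(i, a), (i, b)} | i a b. i < k \<and> a < 3 \<and> b < 3 \<and> a \<noteq> b})"

(* An edge-coloring is a total function on sets of vertices; only its values on the edges matter. *)
definition rainbow :: "('a set \<Rightarrow> nat) \<Rightarrow> 'a graph \<Rightarrow> bool" where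
  "rainbow f G \<longleftrightarrow> inj_on f (edges G)"

definition contains_rainbow :: "('a set \<Rightarrow> nat) \<Rightarrow> 'a graph \<Rightarrow> 'b graph \<Rightarrow> bool" where
  "contains_rainbow f G H \<longleftrightarrow> (\<exists>S. subgraph S G \<and> graph_iso S H \<and> rainbow f S)"

definition color_numbers :: "nat \<Rightarrow> 'b graph \<Rightarrow> nat set" where
  "color_numbers n H = {card (f ` edges (complete_graph n)) | f :: nat set \<Rightarrow> nat.
     \<not> contains_rainbow f (complete_graph n) H}"

(* Max is unspecified on the empty set; color_numbers_nonempty below rules this case out
   whenever H has at least two edges. *)
definition anti_ramsey :: "nat \<Rightarrow> 'b graph \<Rightarrow> nat" where
  "anti_ramsey n H = Max (color_numbers n H)"

lemma finite_color_numbers: "finite (color_numbers n H)"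
proof -
  have fin: "finite (edges (complete_graph n))"
    by (simp add: complete_graph_def finite_imp_finite_nsets)
  have "color_numbers n H \<subseteq> {..card (edges (complete_graph n))}"
    unfolding color_numbers_def using card_image_le[OF fin] by blast
  then show ?thesis
    by (rule finite_subset) simp
qed

lemma color_numbers_nonempty:
  assumes "e \<in> edges H" "e' \<in> edges H" "e \<noteq> e'"
  shows "color_numbers n H \<noteq> {}"
proof -
  have "\<not> contains_rainbow (\<lambda>_. 0) (complete_graph n) H"
  proof
    assume "contains_rainbow (\<lambda>_. 0) (complete_graph n) H"
    then obtain S :: "nat graph" where iso: "graph_iso S H" and rb: "rainbow (\<lambda>_. 0) S"
      by (auto simp: contains_rainbow_def)
    from iso obtain \<phi> where img: "(\<lambda>e. \<phi> ` e) ` edges S = edges H"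
      by (auto simp: graph_iso_def)
    from assms(1) obtain d where d: "d \<in> edges S" "e = \<phi> ` d"
      unfolding img[symmetric] by (rule imageE)
    from assms(2) obtain d' where d': "d' \<in> edges S" "e' = \<phi> ` d'"
      unfolding img[symmetric] by (rule imageE)
    have "d = d'"
      using rb unfolding rainbow_def by (rule inj_onD[OF _ refl d(1) d'(1)])
    with d(2) d'(2) assms(3) show False
      by simp
  qed
  then show ?thesis
    unfolding color_numbers_def by blast
qed

end

theory Submission
  imports Defs "HOL-Library.Nat_Bijection"
begin

text \<open>
  Take \<open>K\<^bsub>n/2,n/2\<^esub>\<close>, add a clique \<open>X\<close> on \<open>2k - 3\<close> vertices inside one side, give the edges
  of this graph pairwise different colors and all remaining edges one further color. Every triangle
  of the graph has two vertices in \<open>X\<close>, so it has at most \<open>k - 2\<close> disjoint triangles, whereas all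
  but at most one of the triangles of a rainbow \<open>kC\<^sub>3\<close> would lie in the graph. For \<open>n = 4k\<close> this uses
  \<open>6k\<^sup>2 - O(k)\<close> colors against \<open>23k\<^sup>2/4 + O(k)\<close> in the formula; \<open>k = 14\<close> is already large enough,
  with \<open>1085\<close> colors against \<open>1079\<close>.
\<close>

text \<open>Edges of \<open>G\<close> outside \<open>E\<close> share one color, so a rainbow copy
  uses at most one of them and keeps at least \<open>k - 1\<close> disjoint triangles inside
  \<open>E\<close>. Each takes two vertices of \<open>X\<close>, and \<open>X\<close> has too few
  for that.\<close>

lemma no_rainbow_disjoint_triangles:
  fixes f :: "'a set \<Rightarrow> nat"
  assumes X: "finite X" "card X < 2 * (k - 1)"
    and mono: "\<And>e e'. e \<in> edges G - E \<Longrightarrow> e' \<in> edges G - E \<Longrightarrow> f e = f e'"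
    and tri: "\<And>a b c. \<lbrakk>a \<noteq> b; b \<noteq> c; a \<noteq> c; {a, b} \<in> E; {b, c} \<in> E; {a, c} \<in> E\<rbrakk>
      \<Longrightarrow> 2 \<le> card ({a, b, c} \<inter> X)"
  shows "\<not> contains_rainbow f G (disjoint_triangles k)"
proof
  assume "contains_rainbow f G (disjoint_triangles k)"
  then obtain S \<phi> where sub: "subgraph S G" and inj: "inj_on f (edges S)"
    and bij: "bij_betw \<phi> (verts S) ({..<k} \<times> {..<3})"
    and img: "(\<lambda>e. \<phi> ` e) ` edges S = edges (disjoint_triangles k)"
    by (auto simp: contains_rainbow_def graph_iso_def rainbow_def disjoint_triangles_def)
  \<comment> \<open>Inverting the isomorphism names the vertices of the copy by triangle and corner,
    so disjointness of the triangles becomes injectivity of \<open>\<psi>\<close>.\<close>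
  define \<psi> where "\<psi> = inv_into (verts S) \<phi>"
  have inj\<psi>: "inj_on \<psi> ({..<k} \<times> {..<3})"
    using bij_betw_inv_into[OF bij] by (simp add: \<psi>_def bij_betw_def)
  have \<psi>_eq: "\<psi> (i, a) = \<psi> (j, b) \<longleftrightarrow> i = j \<and> a = b" if "i < k" "j < k" "a < 3" "b < 3" for i j a b
    using inj_on_eq_iff[OF inj\<psi>, of "(i, a)" "(j, b)"] that by simp
  have edge: "{\<psi> (i, a), \<psi> (i, b)} \<in> edges S" if "i < k" "a < 3" "b < 3" "a \<noteq> b" for i a b
  proof -
    have "{(i, a), (i, b)} \<in> edges (disjoint_triangles k)"
      using that by (auto simp: disjoint_triangles_def)
    then obtain d where d: "d \<in> edges S" "{(i, a), (i, b)} = \<phi> ` d"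
      unfolding img[symmetric] by blast
    have "d \<subseteq> verts S"
      using sub d(1) by (auto simp: subgraph_def simple_graph_def nsets_def)
    then have "\<psi> ` \<phi> ` d = d"
      unfolding \<psi>_def using bij by (simp add: inv_into_image_cancel bij_betw_def)
    then show ?thesis
      using d by (metis image_insert image_empty)
  qed
  define bad where "bad i \<longleftrightarrow> (\<exists>a b. a < 3 \<and> b < 3 \<and> a \<noteq> b \<and> {\<psi> (i, a), \<psi> (i, b)} \<notin> E)" for i
  \<comment> \<open>The edges outside \<open>E\<close> that witness \<open>bad i\<close> and
    \<open>bad j\<close> have equal colors, hence coincide in a rainbow copy; distinct triangles
    share no vertex, let alone an edge.\<close>
  have bad_unique: "i = j" if "i < k" "j < k" "bad i" "bad j" for i j
  proof -
    obtain a b where ab: "a < 3" "b < 3" "a \<noteq> b" "{\<psi> (i, a), \<psi> (i, b)} \<notin> E"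
      using \<open>bad i\<close> by (auto simp: bad_def)
    obtain c d where cd: "c < 3" "d < 3" "c \<noteq> d" "{\<psi> (j, c), \<psi> (j, d)} \<notin> E"
      using \<open>bad j\<close> by (auto simp: bad_def)
    have S: "{\<psi> (i, a), \<psi> (i, b)} \<in> edges S" "{\<psi> (j, c), \<psi> (j, d)} \<in> edges S"
      using edge that ab cd by auto
    moreover have "edges S \<subseteq> edges G"
      using sub by (simp add: subgraph_def)
    ultimately have "f {\<psi> (i, a), \<psi> (i, b)} = f {\<psi> (j, c), \<psi> (j, d)}"
      using mono ab cd by blast
    then have "{\<psi> (i, a), \<psi> (i, b)} = {\<psi> (j, c), \<psi> (j, d)}"
      using inj_onD[OF inj _ S] by blast
    then have "\<psi> (i, a) = \<psi> (j, c) \<or> \<psi> (i, a) = \<psi> (j, d)"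
      by blast
    then show ?thesis
      using \<psi>_eq that ab cd by blast
  qed
  define I where "I = {i. i < k \<and> \<not> bad i}"
  define T where "T i = {\<psi> (i, 0), \<psi> (i, 1), \<psi> (i, 2)}" for i
  have "card {i. i < k \<and> bad i} \<le> 1"
    using bad_unique by (auto simp: card_le_Suc0_iff_eq)
  moreover have "{..<k} = I \<union> {i. i < k \<and> bad i}"
    by (auto simp: I_def)
  then have "k \<le> card I + card {i. i < k \<and> bad i}"
    by (metis card_Un_le card_lessThan)
  ultimately have "k - 1 \<le> card I"
    by linarith
  have "2 \<le> card (T i \<inter> X)" if "i \<in> I" for i
  proof -
    have in_E: "{\<psi> (i, a), \<psi> (i, b)} \<in> E" if "a < 3" "b < 3" "a \<noteq> b" for a b
      using \<open>i \<in> I\<close> that by (auto simp: I_def bad_def)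
    then show ?thesis
      unfolding T_def using \<open>i \<in> I\<close> by (intro tri in_E) (simp_all add: I_def \<psi>_eq)
  qed
  \<comment> \<open>The sets \<open>T i \<inter> X\<close> are pairwise disjoint, so their sizes add
    up to at most \<open>card X\<close>.\<close>
  then have "2 * card I \<le> (\<Sum>i\<in>I. card (T i \<inter> X))"
    using sum_bounded_below[of I 2 "\<lambda>i. card (T i \<inter> X)"] by (simp add: mult.commute)
  also have "\<dots> = card (\<Union>i\<in>I. T i \<inter> X)"
    by (rule card_UN_disjoint[symmetric]) (use X in \<open>auto simp: I_def T_def \<psi>_eq\<close>)
  also have "\<dots> \<le> card X"
    using X by (intro card_mono) auto
  finally show False
    using X \<open>k - 1 \<le> card I\<close> by linarith
qed

text \<open>Coloring \<open>E\<close> injectively and all other edges with one extra color meets the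
  previous lemma. The inclusion of \<open>E\<close> is strict so that the extra color really
  occurs.\<close>

lemma anti_ramsey_disjoint_triangles_ge:
  assumes X: "finite X" "card X < 2 * (k - 1)"
    and E: "E \<subset> edges (complete_graph n)"
    and tri: "\<And>a b c. \<lbrakk>a \<noteq> b; b \<noteq> c; a \<noteq> c; {a, b} \<in> E; {b, c} \<in> E; {a, c} \<in> E\<rbrakk>
      \<Longrightarrow> 2 \<le> card ({a, b, c} \<inter> X)"
  shows "card E + 1 \<le> anti_ramsey n (disjoint_triangles k)"
proof -
  \<comment> \<open>\<open>set_encode\<close> is injective on finite sets, and \<open>Suc\<close>
    keeps 0 free for the edges outside \<open>E\<close>.\<close>
  define f where "f e = (if e \<in> E then Suc (set_encode e) else 0)" for e
  have "\<not> contains_rainbow f (complete_graph n) (disjoint_triangles k)"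
    by (rule no_rainbow_disjoint_triangles[OF X _ tri]) (auto simp: f_def)
  then have "card (f ` edges (complete_graph n)) \<in> color_numbers n (disjoint_triangles k)"
    unfolding color_numbers_def by blast
  then have "card (f ` edges (complete_graph n)) \<le> anti_ramsey n (disjoint_triangles k)"
    unfolding anti_ramsey_def by (intro Max_ge finite_color_numbers)
  moreover have "f ` edges (complete_graph n) = insert 0 (f ` E)"
    using E by (force simp: f_def)
  moreover have "E \<subseteq> Collect finite"
    using E by (auto simp: complete_graph_def nsets_def)
  then have "inj_on f E"
    using inj_on_set_encode by (auto simp: inj_on_def f_def)
  then have "card (f ` E) = card E"
    by (rule card_image)
  moreover have "finite E"
    using E by (auto simp: complete_graph_def intro: finite_imp_finite_nsets finite_subset)
  moreover have "0 \<notin> f ` E"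
    by (auto simp: f_def)
  ultimately show ?thesis
    by simp
qed

lemma anti_ramsey_56_14_ge: "1085 \<le> anti_ramsey 56 (disjoint_triangles 14)"
proof -
  \<comment> \<open>The sides have 56 / 2 = 28 vertices, and the clique has 2 * 14 - 3 = 25. The
    colors number 28 * 28 + 300 + 1 = 1085.\<close>
  define B where "B = (\<lambda>(u, v). {u, v}) ` ({..<28} \<times> {28..<56::nat})"
  define E where "E = [{..<25}]\<^bsup>2\<^esup> \<union> B"
  have "inj_on (\<lambda>(u, v). {u, v}) ({..<28} \<times> {28..<56::nat})"
    by (auto simp: inj_on_def doubleton_eq_iff)
  then have cardB: "card B = 784"
    by (simp add: B_def card_image)
  have "[{..<25}]\<^bsup>2\<^esup> \<inter> B = {}"
    by (auto simp: B_def nsets_def)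
  moreover have "card ([{..<25::nat}]\<^bsup>2\<^esup>) = 300"
    by (simp add: card_nsets choose_two)
  moreover have "finite B" "finite ([{..<25::nat}]\<^bsup>2\<^esup>)"
    by (simp_all add: B_def finite_imp_finite_nsets)
  ultimately have card: "card E = 1084"
    using cardB by (simp add: E_def card_Un_disjoint)
  have E_iff: "{u, v} \<in> E \<longleftrightarrow> u < 25 \<and> v < 25 \<or> u < 28 \<and> 28 \<le> v \<and> v < 56 \<or> v < 28 \<and> 28 \<le> u \<and> u < 56"
    if "u \<noteq> v" for u v
    using that by (auto simp: E_def B_def nsets_def image_iff doubleton_eq_iff)
  have "card E + 1 \<le> anti_ramsey 56 (disjoint_triangles 14)"
  proof (rule anti_ramsey_disjoint_triangles_ge[where X = "{..<25}"])
    have "E \<subseteq> edges (complete_graph 56)"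
      by (auto simp: E_def B_def complete_graph_def nsets_def)
    moreover have "{54, 55} \<in> edges (complete_graph 56)" "{54, 55} \<notin> E"
      by (simp_all add: complete_graph_def nsets_def E_iff)
    ultimately show "E \<subset> edges (complete_graph 56)"
      by blast
  next
    fix a b c :: nat
    assume neq: "a \<noteq> b" "b \<noteq> c" "a \<noteq> c" and in_E: "{a, b} \<in> E" "{b, c} \<in> E" "{a, c} \<in> E"
    \<comment> \<open>A vertex of the triangle that is at least 28 has both neighbors below 28, and
      these are adjacent only if both are below 25. Without such a vertex, all three are below
      25.\<close>
    then have "a < 25 \<and> b < 25 \<or> b < 25 \<and> c < 25 \<or> a < 25 \<and> c < 25"
      by (simp add: E_iff) linarith
    then obtain u v where "u \<noteq> v" "{u, v} \<subseteq> {a, b, c} \<inter> {..<25}"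
      using neq by auto
    then show "2 \<le> card ({a, b, c} \<inter> {..<25})"
      using card_mono[of "{a, b, c} \<inter> {..<25}" "{u, v}"] by simp
  qed simp_all
  then show ?thesis
    by (simp add: card)
qed

theorem theorem1:
  shows "\<not> (\<forall>k n :: nat. k \<ge> 2 \<longrightarrow> n \<ge> 3 * k \<longrightarrow>
    anti_ramsey n (disjoint_triangles k) =
      max (((3 * k - 1) choose 2) + n - 3 * k + 1)
          (nat \<lfloor>(real n - real k + 2)\<^sup>2 / 4\<rfloor> + (k - 2) * (n - k + 2) + ((k - 2) choose 2) + 1))"
proof
  assume "\<forall>k n :: nat. k \<ge> 2 \<longrightarrow> n \<ge> 3 * k \<longrightarrow>
    anti_ramsey n (disjoint_triangles k) =
      max (((3 * k - 1) choose 2) + n - 3 * k + 1)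
          (nat \<lfloor>(real n - real k + 2)\<^sup>2 / 4\<rfloor> + (k - 2) * (n - k + 2) + ((k - 2) choose 2) + 1)"
  \<comment> \<open>The first term is 820 + 15 = 835, the second 484 + 528 + 66 + 1 = 1079.\<close>
  from this[rule_format, of 14 56] have "anti_ramsey 56 (disjoint_triangles 14) = 1079"
    by (simp add: choose_two)
  then show False
    using anti_ramsey_56_14_ge by simp
qed

end
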